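(* Let $3\le s\le r$ and $t\ge 1$ be integers. Then there is no $t$-PDDS$[P_s\square P_r]$ in $\Lambda_2$.
   Context: $\Lambda_2$ is the infinite graph with vertex set $\mathbb{Z}^2$ in which two vertices are adjacent iff their Euclidean distance is $1$; $d$ denotes graph distance. For $S$ a set of vertices, $[S]$ is the induced subgraph and $d(v,C)=\min\{d(v,w):w\in C\}$. For $t\ge1$, $S$ is a $t$-perfect distance-dominating set ($t$-PDDS) if for each vertex $v$ there is a unique component $C_v$ of $[S]$ with $d(v,C_v)\le t$, and there is in $C_v$ a unique vertex $w$ with $d(v,w)=d(v,C_v)$. A $t$-PDDS$[H]$ is a $t$-PDDS all of whose components are isomorphic to the fixed finite graph $H$. $P_k$ is the path on $k$ vertices and $\square$ is the Cartesian product of graphs. *)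

theory Defs
  imports "Graph_Theory.Graph_Theory" "HOL-Analysis.Product_Vector"
begin

text \<open>Undirected simple graphs are represented as symmetric loop-free digraphs without parallel
  arcs; the connected components of such a graph are its strongly connected components.\<close>

text \<open>Euclidean distance is the metric of the product type \<open>real \<times> real\<close>.\<close>

definition Lambda2 :: "(int \<times> int) pair_pre_digraph" where
  "Lambda2 = \<lparr> pverts = UNIV,
     parcs = {((a, b), (c, d)) | a b c d.
       dist (real_of_int a, real_of_int b) (real_of_int c, real_of_int d) = 1} \<rparr>"

definition path_graph :: "nat \<Rightarrow> nat pair_pre_digraph" where
  "path_graph k = \<lparr> pverts = {..<k},
     parcs = {(i, j). i < k \<and> j < k \<and> (j = Suc i \<or> i = Suc j)} \<rparr>"

definition cartesian_product ::
    "'a pair_pre_digraph \<Rightarrow> 'b pair_pre_digraph \<Rightarrow> ('a \<times> 'b) pair_pre_digraph"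
    (infixr \<open>\<box>\<close> 70) where
  "G \<box> H = \<lparr> pverts = pverts G \<times> pverts H,
     parcs = {((a, x), (b, y)) | a x b y.
       (a = b \<and> a \<in> pverts G \<and> (x, y) \<in> parcs H) \<or>
       ((a, b) \<in> parcs G \<and> x = y \<and> x \<in> pverts H)} \<rparr>"

text \<open>Shortest walks under unit arc weights; the value is \<open>\<infinity>\<close> between different components.\<close>

definition graph_dist :: "('a, 'b) pre_digraph \<Rightarrow> 'a \<Rightarrow> 'a \<Rightarrow> ereal" where
  "graph_dist G u v = wf_digraph.\<mu> G (\<lambda>_. 1) u v"

text \<open>All distances are natural numbers or \<open>\<infinity>\<close>, so the infimum over a nonempty \<open>C\<close> is a minimum.\<close>

definition set_graph_dist :: "('a, 'b) pre_digraph \<Rightarrow> 'a \<Rightarrow> 'a set \<Rightarrow> ereal" where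
  "set_graph_dist G v C = (INF w\<in>C. graph_dist G v w)"

definition graph_components :: "('a, 'b) pre_digraph \<Rightarrow> ('a, 'b) pre_digraph set" where
  "graph_components G = pre_digraph.sccs G"

definition PDDS :: "('a, 'b) pre_digraph \<Rightarrow> nat \<Rightarrow> 'a set \<Rightarrow> bool" where
  "PDDS G t S \<longleftrightarrow> S \<subseteq> verts G \<and>
     (\<forall>v \<in> verts G.
        (\<exists>!C. C \<in> graph_components (G \<restriction> S) \<and> set_graph_dist G v (verts C) \<le> ereal (real t)) \<and>
        (\<forall>C \<in> graph_components (G \<restriction> S). set_graph_dist G v (verts C) \<le> ereal (real t) \<longrightarrow>
           (\<exists>!w. w \<in> verts C \<and> graph_dist G v w = set_graph_dist G v (verts C))))"

definition PDDS_of ::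
    "('a, 'b) pre_digraph \<Rightarrow> nat \<Rightarrow> ('c, 'd) pre_digraph \<Rightarrow> 'a set \<Rightarrow> bool" where
  "PDDS_of G t H S \<longleftrightarrow> PDDS G t S \<and> (\<forall>C \<in> graph_components (G \<restriction> S). digraph_iso C H)"

lemma sym_digraph_Lambda2: "sym_digraph (with_proj Lambda2)"
  by unfold_locales (auto simp: Lambda2_def symmetric_def sym_def dist_commute)

lemma loopfree_digraph_Lambda2: "loopfree_digraph (with_proj Lambda2)"
  by unfold_locales (auto simp: Lambda2_def)

end

theory Submission
  imports Defs
begin

text \<open>Every 4-cycle of \<open>\<Lambda>\<^sub>2\<close> is a unit square, so a copy of \<open>P\<^sub>s \<box> P\<^sub>r\<close> is an axis-parallel
  rectangle, and the points within distance \<open>t\<close> of it form an octagon with four staircase corners.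
  A \<open>t\<close>-PDDS would tile the plane by such octagons. Let \<open>T\<close> be a tile whose rectangle has upper right
  corner \<open>(r, u)\<close>. The tile \<open>T'\<close> covering the first notch \<open>(r + 1, u + t)\<close> of the upper right staircase
  of \<open>T\<close> must meet it in a step of its own lower left staircase, which leaves \<open>t + 1\<close> positions. If \<open>T'\<close>
  is shifted along the staircase by two steps or more from the lowest position, some notch of \<open>T\<close> is
  enclosed on the left, below and above, which no tile can fill. In the two remaining positions \<open>T'\<close>
  abuts the last cell of a straight side of \<open>T\<close>; since that side has at least three cells, the tile
  covering the next cell along it would need its staircase to run through \<open>T\<close>.\<close>

subsection \<open>Octagons\<close>

text \<open>The L1 distance of a point to a nonempty rectangle is
  \<open>max(0, l - x, x - r) + max(0, b - y, y - u)\<close>. Bounding it by \<open>t\<close> splits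
  into these inequalities together with \<open>0 \<le> t\<close>; being linear, they suit arithmetic
  provers.\<close>

definition octagon :: "int \<Rightarrow> int \<Rightarrow> int \<Rightarrow> int \<Rightarrow> int \<Rightarrow> (int \<times> int) set" where
  "octagon t l r b u = {(x, y). l - x \<le> t \<and> x - r \<le> t \<and> b - y \<le> t \<and> y - u \<le> t \<and>
     (l - x) + (b - y) \<le> t \<and> (l - x) + (y - u) \<le> t \<and>
     (x - r) + (b - y) \<le> t \<and> (x - r) + (y - u) \<le> t}"

text \<open>Clamping \<open>x\<close> to the interval. The three values are the terms of the maximum
  behind \<open>octagon\<close>, so a choice in each coordinate selects the inequality to
  apply.\<close>

lemma nearest_in_interval:
  fixes l r x :: int
  assumes "l \<le> r"
  obtains x' where "x' \<in> {l..r}" "\<bar>x - x'\<bar> = 0 \<or> \<bar>x - x'\<bar> = l - x \<or> \<bar>x - x'\<bar> = x - r"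
proof -
  consider "x < l" | "r < x" | "x \<in> {l..r}" by fastforce
  then show thesis
    by cases (use assms that[of l] that[of r] that[of x] in auto)
qed

lemma octagon_iff_near_rectangle:
  assumes "0 \<le> t" "l \<le> r" "b \<le> u"
  shows "(x, y) \<in> octagon t l r b u \<longleftrightarrow>
    (\<exists>x' y'. x' \<in> {l..r} \<and> y' \<in> {b..u} \<and> \<bar>x - x'\<bar> + \<bar>y - y'\<bar> \<le> t)"
proof
  assume p: "(x, y) \<in> octagon t l r b u"
  obtain x' where x': "x' \<in> {l..r}" "\<bar>x - x'\<bar> = 0 \<or> \<bar>x - x'\<bar> = l - x \<or> \<bar>x - x'\<bar> = x - r"
    using nearest_in_interval[OF assms(2)] by blast
  obtain y' where y': "y' \<in> {b..u}" "\<bar>y - y'\<bar> = 0 \<or> \<bar>y - y'\<bar> = b - y \<or> \<bar>y - y'\<bar> = y - u"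
    using nearest_in_interval[OF assms(3)] by blast
  have "\<bar>x - x'\<bar> + \<bar>y - y'\<bar> \<le> t"
    using x'(2) y'(2) p assms(1) unfolding octagon_def mem_Collect_eq case_prod_conv
    by (elim disjE conjE) simp_all
  then show "\<exists>x' y'. x' \<in> {l..r} \<and> y' \<in> {b..u} \<and> \<bar>x - x'\<bar> + \<bar>y - y'\<bar> \<le> t"
    using x'(1) y'(1) by blast
next
  assume "\<exists>x' y'. x' \<in> {l..r} \<and> y' \<in> {b..u} \<and> \<bar>x - x'\<bar> + \<bar>y - y'\<bar> \<le> t"
  then obtain x' y' where *: "l \<le> x'" "x' \<le> r" "b \<le> y'" "y' \<le> u" "\<bar>x - x'\<bar> + \<bar>y - y'\<bar> \<le> t"
    by auto
  moreover have "x' - x \<le> \<bar>x - x'\<bar>" "x - x' \<le> \<bar>x - x'\<bar>" "y' - y \<le> \<bar>y - y'\<bar>" "y - y' \<le> \<bar>y - y'\<bar>"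
    "0 \<le> \<bar>x - x'\<bar>" "0 \<le> \<bar>y - y'\<bar>" by linarith+
  ultimately show "(x, y) \<in> octagon t l r b u"
    unfolding octagon_def mem_Collect_eq case_prod_conv by (intro conjI; linarith)
qed

section \<open>Staircase corners and forbidden local patterns\<close>

text \<open>A step left can only violate a tight inequality containing \<open>l - x\<close>, a step
  down only a tight one containing \<open>b - y\<close>. With at least two columns and two rows in
  the rectangle, both happen only on the lower left staircase.\<close>

lemma octagon_lower_left_corner:
  assumes "(x, y) \<in> octagon t l r b u" "(x - 1, y) \<notin> octagon t l r b u"
    "(x, y - 1) \<notin> octagon t l r b u" "0 \<le> t" "l < r" "b < u"
  shows "x \<le> l \<and> y \<le> b \<and> (l - x) + (b - y) = t"
  using assms unfolding octagon_def mem_Collect_eq case_prod_conv by (smt (verit))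

text \<open>Such a cell would be a lower left corner, hence at height at most \<open>b\<close>. As
  \<open>b < u\<close>, the cell above it still satisfies every inequality.\<close>

lemma octagon_no_thin_left_end:
  assumes "(x, y) \<in> octagon t l r b u" "(x - 1, y) \<notin> octagon t l r b u"
    "(x, y - 1) \<notin> octagon t l r b u" "(x, y + 1) \<notin> octagon t l r b u"
    "0 \<le> t" "l < r" "b < u"
  shows False
  using octagon_lower_left_corner[OF assms(1-3,5-7)] assms(4-7)
  unfolding octagon_def mem_Collect_eq case_prod_conv by (smt (verit))

text \<open>The first two exclusions put the cell on the lower right staircase. Since
  \<open>1 \<le> t\<close>, this staircase has at least two corners, so one of the two diagonal
  neighbours is a corner as well.\<close>

lemma octagon_no_lower_right_hook:
  assumes "(x, y) \<in> octagon t l r b u" "(x + 1, y) \<notin> octagon t l r b u"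
    "(x, y - 1) \<notin> octagon t l r b u" "(x + 1, y + 1) \<notin> octagon t l r b u"
    "(x - 1, y - 1) \<notin> octagon t l r b u" "1 \<le> t" "l < r" "b < u"
  shows False
  using assms unfolding octagon_def mem_Collect_eq case_prod_conv by (smt (verit))

text \<open>The preceding pattern reflected in the diagonal \<open>x = y\<close>.\<close>

lemma octagon_no_upper_left_hook:
  assumes "(x, y) \<in> octagon t l r b u" "(x, y + 1) \<notin> octagon t l r b u"
    "(x - 1, y) \<notin> octagon t l r b u" "(x + 1, y + 1) \<notin> octagon t l r b u"
    "(x - 1, y - 1) \<notin> octagon t l r b u" "1 \<le> t" "l < r" "b < u"
  shows False
  using assms unfolding octagon_def mem_Collect_eq case_prod_conv by (smt (verit))

section \<open>Impossibility of an octagon tiling\<close>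

lemma no_octagon_tiling:
  fixes t :: int and F :: "(int \<times> int \<times> int \<times> int) set"
  assumes t: "1 \<le> t"
    and sides: "\<And>l r b u. (l, r, b, u) \<in> F \<Longrightarrow> l + 2 \<le> r \<and> b + 2 \<le> u"
    and cover: "\<And>p. \<exists>l r b u. (l, r, b, u) \<in> F \<and> p \<in> octagon t l r b u"
    and disjoint: "\<And>p l r b u l' r' b' u'. (l, r, b, u) \<in> F \<Longrightarrow> (l', r', b', u') \<in> F \<Longrightarrow>
      p \<in> octagon t l r b u \<Longrightarrow> p \<in> octagon t l' r' b' u' \<Longrightarrow>
      (l, r, b, u) = (l', r', b', u')"
  shows False
proof -
  \<comment> \<open>A cell \<open>p\<close> that lies in only one of two tiles shows them to be
    different, hence disjoint. Below, \<open>p\<close> is the cell that a new tile must cover and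
    \<open>q\<close> a cell near it held by an old tile.\<close>
  have avoid: "q \<notin> octagon t l' r' b' u'"
    if "(l, r, b, u) \<in> F" "(l', r', b', u') \<in> F" "p \<in> octagon t l' r' b' u'"
      "p \<notin> octagon t l r b u" "q \<in> octagon t l r b u" for p q l r b u l' r' b' u'
    using disjoint[of l r b u l' r' b' u' q] that by auto
  obtain l r b u where T: "(l, r, b, u) \<in> F" using cover by blast
  note sT = sides[OF T]
  have out: "(r + 1, u + t) \<notin> octagon t l r b u" by (simp add: octagon_def)
  obtain l' r' b' u' where T': "(l', r', b', u') \<in> F"
    and p: "(r + 1, u + t) \<in> octagon t l' r' b' u'" using cover by blast
  note sT' = sides[OF T']
  note avT' = avoid[OF T T' p out]
  \<comment> \<open>The left and lower neighbours of the notch belong to \<open>T\<close>, so the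
    notch is a lower left corner of \<open>T'\<close>.\<close>
  have "(r + 1 - 1, u + t) \<notin> octagon t l' r' b' u'"
    by (rule avT') (use sT t in \<open>simp add: octagon_def\<close>)
  moreover have "(r + 1, u + t - 1) \<notin> octagon t l' r' b' u'"
    by (rule avT') (use sT t in \<open>simp add: octagon_def\<close>)
  ultimately have c: "r + 1 \<le> l'" "u + t \<le> b'" "(l' - (r + 1)) + (b' - (u + t)) = t"
    using octagon_lower_left_corner[OF p] sT' t by auto
  \<comment> \<open>The lower left corners of \<open>T'\<close> are the cells
    \<open>(r + 1 + k, u + t - k)\<close> with \<open>i - t \<le> k \<le> i\<close>, while the
    notches of \<open>T\<close> are those with \<open>0 \<le> k < t\<close>.\<close>
  define i where "i = l' - (r + 1)"
  have l': "l' = r + 1 + i" and b': "b' = u + 2 * t - i" and i: "0 \<le> i" "i \<le> t"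
    using c by (auto simp: i_def)
  consider "i = t" | "i = t - 1" | "i \<le> t - 2" using i by linarith
  then show False
  proof cases
    case 1
    \<comment> \<open>The corner \<open>(r + 1 + t, u)\<close> of \<open>T'\<close> abuts the top
      cell of the right side of \<open>T\<close>, and \<open>?q\<close> is just below it.
      \<open>T'\<close> holds the cells above and upper right of \<open>?q\<close>, \<open>T\<close>
      those left and lower left, the last one by \<open>b + 2 \<le> u\<close>.\<close>
    let ?q = "(r + 1 + t, u - 1)"
    have q: "?q \<notin> octagon t l r b u" "?q \<notin> octagon t l' r' b' u'"
      using 1 l' b' by (simp_all add: octagon_def)
    obtain l3 r3 b3 u3 where T3: "(l3, r3, b3, u3) \<in> F" and q3: "?q \<in> octagon t l3 r3 b3 u3"
      using cover by blast
    show False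
    proof (rule octagon_no_upper_left_hook[OF q3 _ _ _ _ t])
      show "(r + 1 + t, u - 1 + 1) \<notin> octagon t l3 r3 b3 u3"
        "(r + 1 + t + 1, u - 1 + 1) \<notin> octagon t l3 r3 b3 u3"
        by (rule avoid[OF T' T3 q3 q(2)], use 1 l' b' sT' t in \<open>simp add: octagon_def\<close>)+
      show "(r + 1 + t - 1, u - 1) \<notin> octagon t l3 r3 b3 u3"
        "(r + 1 + t - 1, u - 1 - 1) \<notin> octagon t l3 r3 b3 u3"
        by (rule avoid[OF T T3 q3 q(1)], use sT t in \<open>simp add: octagon_def\<close>)+
    qed (use sides[OF T3] t in auto)
  next
    case 2
    \<comment> \<open>The mirrored situation: the corner \<open>(r, u + t + 1)\<close> of
      \<open>T'\<close> sits on the last cell of the top side of \<open>T\<close>, with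
      \<open>?q\<close> to its left. Here \<open>l + 2 \<le> r\<close> puts
      \<open>(r - 2, u + t)\<close> into \<open>T\<close>.\<close>
    let ?q = "(r - 1, u + t + 1)"
    have q: "?q \<notin> octagon t l r b u" "?q \<notin> octagon t l' r' b' u'"
      using 2 l' b' by (simp_all add: octagon_def)
    obtain l3 r3 b3 u3 where T3: "(l3, r3, b3, u3) \<in> F" and q3: "?q \<in> octagon t l3 r3 b3 u3"
      using cover by blast
    show False
    proof (rule octagon_no_lower_right_hook[OF q3 _ _ _ _ t])
      show "(r - 1 + 1, u + t + 1) \<notin> octagon t l3 r3 b3 u3"
        "(r - 1 + 1, u + t + 1 + 1) \<notin> octagon t l3 r3 b3 u3"
        by (rule avoid[OF T' T3 q3 q(2)], use 2 l' b' sT' t in \<open>simp add: octagon_def\<close>)+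
      show "(r - 1, u + t + 1 - 1) \<notin> octagon t l3 r3 b3 u3"
        "(r - 1 - 1, u + t + 1 - 1) \<notin> octagon t l3 r3 b3 u3"
        by (rule avoid[OF T T3 q3 q(1)], use sT t in \<open>simp add: octagon_def\<close>)+
    qed (use sides[OF T3] t in auto)
  next
    case 3
    \<comment> \<open>The notch with \<open>k = i + 1\<close>, which exists because
      \<open>i \<le> t - 2\<close>. The bottom side of \<open>T'\<close> closes it above,
      \<open>T\<close> on the left and below.\<close>
    let ?q = "(r + 2 + i, u + t - i - 1)"
    have q: "?q \<notin> octagon t l r b u" "?q \<notin> octagon t l' r' b' u'"
      using 3 l' b' by (simp_all add: octagon_def)
    obtain l3 r3 b3 u3 where T3: "(l3, r3, b3, u3) \<in> F" and q3: "?q \<in> octagon t l3 r3 b3 u3"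
      using cover by blast
    show False
    proof (rule octagon_no_thin_left_end[OF q3])
      show "(r + 2 + i, u + t - i - 1 + 1) \<notin> octagon t l3 r3 b3 u3"
        by (rule avoid[OF T' T3 q3 q(2)], use 3 l' b' sT' t i in \<open>simp add: octagon_def\<close>)
      show "(r + 2 + i - 1, u + t - i - 1) \<notin> octagon t l3 r3 b3 u3"
        "(r + 2 + i, u + t - i - 1 - 1) \<notin> octagon t l3 r3 b3 u3"
        by (rule avoid[OF T T3 q3 q(1)], use 3 sT t i in \<open>simp add: octagon_def\<close>)+
    qed (use sides[OF T3] t in auto)
  qed
qed

subsection \<open>Distances in \<open>\<Lambda>\<^sub>2\<close>\<close>

text \<open>Integers satisfy \<open>\<bar>z\<bar> \<le> \<bar>z\<bar>\<^sup>2\<close>, so Euclidean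
  distance 1 bounds the L1 distance by 1, and it is not 0.\<close>

lemma arc_Lambda2_iff: "((a, b), (c, d)) \<in> parcs Lambda2 \<longleftrightarrow> \<bar>a - c\<bar> + \<bar>b - d\<bar> = 1"
proof -
  have "((a, b), (c, d)) \<in> parcs Lambda2 \<longleftrightarrow>
      (real_of_int a - real_of_int c)\<^sup>2 + (real_of_int b - real_of_int d)\<^sup>2 = 1"
    by (simp add: Lambda2_def dist_prod_def dist_real_def)
  also have "\<dots> \<longleftrightarrow> real_of_int ((a - c)\<^sup>2 + (b - d)\<^sup>2) = real_of_int 1" by simp
  also have "\<dots> \<longleftrightarrow> (a - c)\<^sup>2 + (b - d)\<^sup>2 = 1" by (simp only: of_int_eq_iff)
  also have "\<dots> \<longleftrightarrow> \<bar>a - c\<bar> + \<bar>b - d\<bar> = 1"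
  proof
    assume *: "(a - c)\<^sup>2 + (b - d)\<^sup>2 = 1"
    have "\<bar>a - c\<bar>\<^sup>2 + \<bar>b - d\<bar>\<^sup>2 = 1" using * by simp
    moreover have "\<bar>z\<bar> \<le> \<bar>z\<bar>\<^sup>2" for z :: int
      using mult_left_mono[of 1 "\<bar>z\<bar>" "\<bar>z\<bar>"]
      by (cases "z = 0") (simp_all add: power2_eq_square)
    moreover have "\<bar>a - c\<bar> \<noteq> 0 \<or> \<bar>b - d\<bar> \<noteq> 0" using * by auto
    ultimately show "\<bar>a - c\<bar> + \<bar>b - d\<bar> = 1"
      by (smt (verit))
  next
    assume "\<bar>a - c\<bar> + \<bar>b - d\<bar> = 1"
    then have "a - c = 0 \<and> (b - d = 1 \<or> b - d = -1) \<or> b - d = 0 \<and> (a - c = 1 \<or> a - c = -1)"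
      by linarith
    then show "(a - c)\<^sup>2 + (b - d)\<^sup>2 = 1" by auto
  qed
  finally show ?thesis .
qed

definition l1_dist :: "int \<times> int \<Rightarrow> int \<times> int \<Rightarrow> int" where
  "l1_dist p q = \<bar>fst p - fst q\<bar> + \<bar>snd p - snd q\<bar>"

lemma arc_Lambda2_l1_dist: "(p, q) \<in> parcs Lambda2 \<longleftrightarrow> l1_dist p q = 1"
  by (cases p; cases q) (simp add: arc_Lambda2_iff l1_dist_def)

interpretation L2: sym_digraph "with_proj Lambda2" by (rule sym_digraph_Lambda2)

lemma pverts_Lambda2 [simp]: "pverts Lambda2 = UNIV"
  by (simp add: Lambda2_def)

lemma l1_dist_le_awalk_length:
  assumes "L2.awalk p es q"
  shows "l1_dist p q \<le> int (length es)"
  using assms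
proof (induction es arbitrary: p)
  case Nil
  then show ?case by (simp add: L2.awalk_Nil_iff l1_dist_def)
next
  case (Cons e es)
  then have "e \<in> parcs Lambda2" "fst e = p" "L2.awalk (snd e) es q"
    by (auto simp: L2.awalk_Cons_iff)
  moreover from this have "l1_dist p (snd e) = 1"
    by (metis arc_Lambda2_l1_dist prod.collapse)
  ultimately show ?case using Cons.IH[of "snd e"] by (simp add: l1_dist_def)
qed

lemma awalk_of_l1_dist: "\<exists>es. L2.awalk p es q \<and> length es = nat (l1_dist p q)"
proof (induction "nat (l1_dist p q)" arbitrary: p)
  case 0
  then have "\<bar>fst p - fst q\<bar> + \<bar>snd p - snd q\<bar> \<le> 0" by (simp add: l1_dist_def)
  then have "fst p = fst q \<and> snd p = snd q" by linarith
  then have "p = q" by (simp add: prod_eq_iff)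
  then show ?case using 0 by (intro exI[of _ "[]"]) (simp add: L2.awalk_Nil_iff)
next
  case (Suc n)
  \<comment> \<open>A unit step towards \<open>q\<close>, vertical once the columns agree and
    horizontal before; \<open>sgn\<close> picks the direction.\<close>
  have "\<exists>p'. l1_dist p p' = 1 \<and> l1_dist p' q = l1_dist p q - 1"
  proof (cases "fst p = fst q")
    case True
    then show ?thesis using Suc.hyps(2)
      by (intro exI[of _ "(fst p, snd p + sgn (snd q - snd p))"])
        (auto simp: l1_dist_def sgn_if)
  next
    case False
    then show ?thesis using Suc.hyps(2)
      by (intro exI[of _ "(fst p + sgn (fst q - fst p), snd p)"])
        (auto simp: l1_dist_def sgn_if)
  qed
  then obtain p' where p': "l1_dist p p' = 1" "l1_dist p' q = l1_dist p q - 1" by blast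
  then have "n = nat (l1_dist p' q)" using Suc.hyps(2) by linarith
  from Suc.hyps(1)[OF this] obtain es where
    es: "L2.awalk p' es q" "length es = nat (l1_dist p' q)" by blast
  have "L2.awalk p ((p, p') # es) q"
    using es p' by (simp add: L2.awalk_Cons_iff arc_Lambda2_l1_dist)
  moreover have "length ((p, p') # es) = nat (l1_dist p q)"
    using es p' Suc.hyps(2) by simp
  ultimately show ?case by blast
qed

lemma graph_dist_Lambda2: "graph_dist (with_proj Lambda2) p q = ereal (real_of_int (l1_dist p q))"
proof -
  have cost: "L2.awalk_cost (\<lambda>_. 1) es = real (length es)" for es :: "((int \<times> int) \<times> (int \<times> int)) list"
    by (induction es) auto
  obtain es where es: "L2.awalk p es q" "length es = nat (l1_dist p q)"
    using awalk_of_l1_dist by blast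
  have nonneg: "0 \<le> l1_dist p q" by (simp add: l1_dist_def)
  have "L2.\<mu> (\<lambda>_. 1) p q \<le> ereal (real_of_int (l1_dist p q))"
    using L2.min_cost_le_walk_cost[OF es(1), of "\<lambda>_. 1"] es(2) nonneg by (simp add: cost)
  moreover have "ereal (real_of_int (l1_dist p q)) \<le> L2.\<mu> (\<lambda>_. 1) p q"
    unfolding L2.\<mu>_def
  proof (rule INF_greatest)
    fix es assume "es \<in> {es. L2.awalk p es q}"
    then have "l1_dist p q \<le> int (length es)" using l1_dist_le_awalk_length by blast
    then have "real_of_int (l1_dist p q) \<le> real (length es)" by linarith
    then show "ereal (real_of_int (l1_dist p q)) \<le> ereal (L2.awalk_cost (\<lambda>_. 1) es)"
      by (simp add: cost)
  qed
  ultimately show ?thesis unfolding graph_dist_def by (rule antisym)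
qed

lemma set_graph_dist_Lambda2_le_iff:
  "set_graph_dist (with_proj Lambda2) p C \<le> ereal (real t) \<longleftrightarrow> (\<exists>q\<in>C. l1_dist p q \<le> int t)"
proof
  assume le: "set_graph_dist (with_proj Lambda2) p C \<le> ereal (real t)"
  show "\<exists>q\<in>C. l1_dist p q \<le> int t"
  proof (rule ccontr)
    assume "\<not> ?thesis"
    \<comment> \<open>Integrality turns \<open>> t\<close> into \<open>\<ge> t + 1\<close>, a gap
      that survives the infimum where a strict inequality need not.\<close>
    then have "\<And>q. q \<in> C \<Longrightarrow> int t + 1 \<le> l1_dist p q" by force
    then have "ereal (real t + 1) \<le> set_graph_dist (with_proj Lambda2) p C"
      unfolding set_graph_dist_def graph_dist_Lambda2 by (intro INF_greatest) force
    then have "ereal (real t + 1) \<le> ereal (real t)" using le by (rule order_trans)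
    then show False by simp
  qed
next
  assume "\<exists>q\<in>C. l1_dist p q \<le> int t"
  then show "set_graph_dist (with_proj Lambda2) p C \<le> ereal (real t)"
    unfolding set_graph_dist_def graph_dist_Lambda2 by (force intro: INF_lower2)
qed

subsection \<open>Grids in \<open>\<Lambda>\<^sub>2\<close>\<close>

text \<open>Two distinct common neighbours force \<open>p\<close> and \<open>z\<close> to be
  diagonally opposite: on a common line, two apart, they would share only the midpoint.\<close>

lemma l1_square:
  assumes "l1_dist p q = 1" "l1_dist p q' = 1" "l1_dist q z = 1" "l1_dist q' z = 1"
    "p \<noteq> z" "q \<noteq> q'"
  shows "z = q + q' - p" "fst q = fst p \<longleftrightarrow> fst q' \<noteq> fst p"
  using assms unfolding l1_dist_def prod_eq_iff fst_add snd_add fst_diff snd_diff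
  by (smt (verit))+

lemma l1_straight:
  assumes "l1_dist p q = 1" "l1_dist q z = 1" "z \<noteq> p" "fst q = fst p \<longleftrightarrow> fst z = fst q"
  shows "z - q = q - p"
  using assms unfolding l1_dist_def prod_eq_iff fst_diff snd_diff
  by (smt (verit))

text \<open>Each cell of the grid maps to a unit square, so opposite edges are equal vectors and
  adjacent edges perpendicular. With both sides at least 2, every edge lies in such a square, which
  keeps rows and columns from bending.\<close>

lemma grid_embedding_affine:
  fixes f :: "nat \<Rightarrow> nat \<Rightarrow> int \<times> int"
  assumes s: "2 \<le> s" and r: "2 \<le> r"
    and inj: "\<And>i j i' j'. i < s \<Longrightarrow> j < r \<Longrightarrow> i' < s \<Longrightarrow> j' < r \<Longrightarrow> f i j = f i' j' \<Longrightarrow> i = i' \<and> j = j'"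
    and right: "\<And>i j. Suc i < s \<Longrightarrow> j < r \<Longrightarrow> l1_dist (f i j) (f (Suc i) j) = 1"
    and up: "\<And>i j. i < s \<Longrightarrow> Suc j < r \<Longrightarrow> l1_dist (f i j) (f i (Suc j)) = 1"
  obtains a c where "l1_dist 0 a = 1" "l1_dist 0 c = 1" "fst a = 0 \<longleftrightarrow> fst c \<noteq> 0"
    "\<And>i j. i < s \<Longrightarrow> j < r \<Longrightarrow>
      f i j = f 0 0 + (int i * fst a, int i * snd a) + (int j * fst c, int j * snd c)"
proof -
  have sq: "f (Suc i) (Suc j) - f i (Suc j) = f (Suc i) j - f i j"
    "f (Suc i) (Suc j) - f (Suc i) j = f i (Suc j) - f i j"
    "fst (f (Suc i) j - f i j) = 0 \<longleftrightarrow> fst (f i (Suc j) - f i j) \<noteq> 0"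
    if ij: "Suc i < s" "Suc j < r" for i j
  proof -
    have "f i j \<noteq> f (Suc i) (Suc j)" "f (Suc i) j \<noteq> f i (Suc j)"
      using inj[of i j "Suc i" "Suc j"] inj[of "Suc i" j i "Suc j"] ij by auto
    from l1_square[OF right up up right this] ij
    show "f (Suc i) (Suc j) - f i (Suc j) = f (Suc i) j - f i j"
      "f (Suc i) (Suc j) - f (Suc i) j = f i (Suc j) - f i j"
      "fst (f (Suc i) j - f i j) = 0 \<longleftrightarrow> fst (f i (Suc j) - f i j) \<noteq> 0"
      by simp_all
  qed
  define a where "a = f 1 0 - f 0 0"
  define c where "c = f 0 1 - f 0 0"
  have ua: "l1_dist 0 a = 1" using right[of 0 0] s r by (simp add: a_def l1_dist_def)
  have uc: "l1_dist 0 c = 1" using up[of 0 0] s r by (simp add: c_def l1_dist_def)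
  have perp: "fst a = 0 \<longleftrightarrow> fst c \<noteq> 0" using sq(3)[of 0 0] s r by (simp add: a_def c_def)
  \<comment> \<open>Carrying \<open>c\<close> along the lowest row of squares supplies the fixed
    perpendicular direction against which \<open>H0\<close> compares the horizontal steps.\<close>
  have V0: "f i 1 - f i 0 = c" if "i < s" for i
    using that
  proof (induction i)
    case (Suc i)
    then show ?case using sq(2)[of i 0] r by simp
  qed (simp add: c_def)
  text \<open>Being perpendicular to the same side, consecutive steps of a row agree up to sign, and
    injectivity excludes a reversal.\<close>
  have H0: "f (Suc i) 0 - f i 0 = a" if "Suc i < s" for i
    using that
  proof (induction i)
    case (Suc i)
    have IH: "f (Suc i) 0 - f i 0 = a" using Suc by simp
    have "fst (f (Suc (Suc i)) 0 - f (Suc i) 0) = 0 \<longleftrightarrow> fst c \<noteq> 0"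
      using sq(3)[of "Suc i" 0] Suc.prems r by (simp add: V0[of "Suc i", symmetric])
    then have "fst (f (Suc i) 0) = fst (f i 0) \<longleftrightarrow> fst (f (Suc (Suc i)) 0) = fst (f (Suc i) 0)"
      using perp unfolding IH[symmetric] by simp
    moreover have "f (Suc (Suc i)) 0 \<noteq> f i 0" using inj[of "Suc (Suc i)" 0 i 0] Suc.prems r by auto
    ultimately show ?case
      using l1_straight[OF right[of i 0] right[of "Suc i" 0]] IH Suc.prems r by simp
  qed (simp add: a_def)
  have H: "f (Suc i) j - f i j = a" if "Suc i < s" "j < r" for i j
    using that
  proof (induction j)
    case (Suc j)
    then show ?case using sq(1)[of i j] by simp
  qed (simp add: H0)
  \<comment> \<open>The argument of \<open>H0\<close> for the left column, with \<open>H\<close>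
    supplying the perpendicular side \<open>a\<close>.\<close>
  have W0: "f 0 (Suc j) - f 0 j = c" if "Suc j < r" for j
    using that
  proof (induction j)
    case (Suc j)
    have IH: "f 0 (Suc j) - f 0 j = c" using Suc by simp
    have "fst a = 0 \<longleftrightarrow> fst (f 0 (Suc (Suc j)) - f 0 (Suc j)) \<noteq> 0"
      using sq(3)[of 0 "Suc j"] Suc.prems s by (simp add: H[of 0 "Suc j", symmetric])
    then have "fst (f 0 (Suc j)) = fst (f 0 j) \<longleftrightarrow> fst (f 0 (Suc (Suc j))) = fst (f 0 (Suc j))"
      using perp unfolding IH[symmetric] by simp
    moreover have "f 0 (Suc (Suc j)) \<noteq> f 0 j" using inj[of 0 "Suc (Suc j)" 0 j] Suc.prems s by auto
    ultimately show ?case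
      using l1_straight[OF up[of 0 j] up[of 0 "Suc j"]] IH Suc.prems s by simp
  qed (simp add: c_def)
  have col: "f 0 j = f 0 0 + (int j * fst c, int j * snd c)" if "j < r" for j
    using that
  proof (induction j)
    case (Suc j)
    then show ?case using W0[of j] by (simp add: prod_eq_iff algebra_simps)
  qed (simp add: zero_prod_def[symmetric])
  have "f i j = f 0 0 + (int i * fst a, int i * snd a) + (int j * fst c, int j * snd c)"
    if "i < s" "j < r" for i j
    using that
  proof (induction i)
    case 0
    then show ?case using col[of j] by (simp add: prod_eq_iff)
  next
    case (Suc i)
    then show ?case using H[of i j] by (simp add: prod_eq_iff algebra_simps)
  qed
  then show thesis by (rule that[OF ua uc perp])
qed

lemma image_mult_unit_interval:
  fixes x e :: int
  assumes "e = 1 \<or> e = -1" "1 \<le> n"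
  obtains l where "(\<lambda>i. x + int i * e) ` {..<n} = {l..l + int n - 1}"
proof -
  have "(\<lambda>i. x + int i * e) ` {..<n} = (\<lambda>k. x + k * e) ` int ` {..<n}"
    by (simp add: image_image)
  also have "int ` {..<n} = {0..int n - 1}"
    by (auto simp: image_iff intro!: bexI[of _ "nat _"])
  finally have eq: "(\<lambda>i. x + int i * e) ` {..<n} = (\<lambda>k. x + k * e) ` {0..int n - 1}" .
  from assms(1) show thesis
  proof
    assume "e = 1"
    then have "(\<lambda>k. x + k * e) ` {0..int n - 1} = {x..x + int n - 1}"
      by (auto simp: image_iff intro!: bexI[of _ "_ - x"])
    then show thesis using eq that by metis
  next
    assume "e = -1"
    then have "(\<lambda>k. x + k * e) ` {0..int n - 1} = {(x - int n + 1)..(x - int n + 1) + int n - 1}"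
      by (auto simp: image_iff intro!: bexI[of _ "x - _"])
    then show thesis using eq that by metis
  qed
qed

text \<open>The unit vectors \<open>a\<close> and \<open>c\<close> point along different axes, so
  the image is a product of two intervals; whether \<open>a\<close> is vertical decides which side
  has length \<open>s\<close>.\<close>

lemma grid_embedding_image_rectangle:
  fixes f :: "nat \<Rightarrow> nat \<Rightarrow> int \<times> int"
  assumes s: "2 \<le> s" and r: "2 \<le> r"
    and inj: "\<And>i j i' j'. i < s \<Longrightarrow> j < r \<Longrightarrow> i' < s \<Longrightarrow> j' < r \<Longrightarrow> f i j = f i' j' \<Longrightarrow> i = i' \<and> j = j'"
    and right: "\<And>i j. Suc i < s \<Longrightarrow> j < r \<Longrightarrow> l1_dist (f i j) (f (Suc i) j) = 1"
    and up: "\<And>i j. i < s \<Longrightarrow> Suc j < r \<Longrightarrow> l1_dist (f i j) (f i (Suc j)) = 1"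
  obtains l m b n where "(\<lambda>(i, j). f i j) ` ({..<s} \<times> {..<r}) = {l..l + int m - 1} \<times> {b..b + int n - 1}"
    "m = s \<and> n = r \<or> m = r \<and> n = s"
proof -
  obtain a c where ac: "l1_dist 0 a = 1" "l1_dist 0 c = 1" "fst a = 0 \<longleftrightarrow> fst c \<noteq> 0"
    and f: "\<And>i j. i < s \<Longrightarrow> j < r \<Longrightarrow>
      f i j = f 0 0 + (int i * fst a, int i * snd a) + (int j * fst c, int j * snd c)"
    by (rule grid_embedding_affine[where f = f, OF s r]) (rule inj right up that; assumption)+
  obtain x y where xy: "f 0 0 = (x, y)" by force
  show thesis
  proof (cases "fst a = 0")
    case True
    then have e: "snd a = 1 \<or> snd a = -1" "fst c = 1 \<or> fst c = -1" "snd c = 0"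
      using ac by (auto simp: l1_dist_def)
    have "(\<lambda>(i, j). f i j) ` ({..<s} \<times> {..<r}) =
        (\<lambda>j. x + int j * fst c) ` {..<r} \<times> (\<lambda>i. y + int i * snd a) ` {..<s}"
      using f True e(3) xy by (force simp: image_iff)
    moreover obtain l where "(\<lambda>j. x + int j * fst c) ` {..<r} = {l..l + int r - 1}"
      using image_mult_unit_interval[OF e(2)] r by (metis one_le_numeral order_trans)
    moreover obtain b where "(\<lambda>i. y + int i * snd a) ` {..<s} = {b..b + int s - 1}"
      using image_mult_unit_interval[OF e(1)] s by (metis one_le_numeral order_trans)
    ultimately show thesis using that by metis
  next
    case False
    then have e: "fst a = 1 \<or> fst a = -1" "snd c = 1 \<or> snd c = -1" "fst c = 0" "snd a = 0"
      using ac by (auto simp: l1_dist_def)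
    have "(\<lambda>(i, j). f i j) ` ({..<s} \<times> {..<r}) =
        (\<lambda>i. x + int i * fst a) ` {..<s} \<times> (\<lambda>j. y + int j * snd c) ` {..<r}"
      using f e(3,4) xy by (force simp: image_iff)
    moreover obtain l where "(\<lambda>i. x + int i * fst a) ` {..<s} = {l..l + int s - 1}"
      using image_mult_unit_interval[OF e(1)] s by (metis one_le_numeral order_trans)
    moreover obtain b where "(\<lambda>j. y + int j * snd c) ` {..<r} = {b..b + int r - 1}"
      using image_mult_unit_interval[OF e(2)] r by (metis one_le_numeral order_trans)
    ultimately show thesis using that by metis
  qed
qed

lemma grid_component_rectangle:
  assumes C: "C \<in> graph_components (with_proj Lambda2 \<restriction> S)"
    and iso: "digraph_iso C (with_proj (path_graph s \<box> path_graph r))"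
    and s: "2 \<le> s" and r: "2 \<le> r"
  obtains l m b n where "verts C = {l..l + int m - 1} \<times> {b..b + int n - 1}"
    "m = s \<and> n = r \<or> m = r \<and> n = s"
proof -
  let ?H = "with_proj (path_graph s \<box> path_graph r)"
  have ind: "induced_subgraph C (with_proj Lambda2 \<restriction> S)"
    using C unfolding graph_components_def by (auto simp: pre_digraph.sccs_def)
  then have arcsC: "arcs C \<subseteq> parcs Lambda2" and tail: "tail C = fst" and head: "head C = snd"
    and wf: "wf_digraph C"
    by (auto simp: induced_subgraph_def subgraph_def compatible_def)
  \<comment> \<open>The isomorphism is inverted so that the grid parametrizes
    \<open>C\<close>.\<close>
  from iso wf have "digraph_iso ?H C" by (metis digraph_iso_swap)
  then obtain h where h: "pre_digraph.digraph_isomorphism ?H h" and Ch: "C = app_iso h ?H"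
    unfolding digraph_iso_def by blast
  have vH: "verts ?H = {..<s} \<times> {..<r}"
    by (simp add: cartesian_product_def path_graph_def)
  define f where "f i j = iso_verts h (i, j)" for i j
  have adj: "l1_dist (iso_verts h p) (iso_verts h q) = 1" if "(p, q) \<in> arcs ?H" for p q
  proof -
    have "iso_arcs h (p, q) \<in> arcs C" using that Ch by simp
    then have "iso_arcs h (p, q) \<in> parcs Lambda2" using arcsC by blast
    moreover have "iso_verts h p = fst (iso_arcs h (p, q))" "iso_verts h q = snd (iso_arcs h (p, q))"
      using h that Ch tail head by (auto simp: pre_digraph.digraph_isomorphism_def)
    ultimately show ?thesis by (simp add: arc_Lambda2_l1_dist[symmetric])
  qed
  have inj: "i = i' \<and> j = j'" if "i < s" "j < r" "i' < s" "j' < r" "f i j = f i' j'" for i j i' j'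
  proof -
    have "inj_on (iso_verts h) (verts ?H)" using h by (simp add: pre_digraph.digraph_isomorphism_def)
    from inj_onD[OF this, of "(i, j)" "(i', j')"] show ?thesis
      using that unfolding vH f_def by simp
  qed
  have right: "l1_dist (f i j) (f (Suc i) j) = 1" if "Suc i < s" "j < r" for i j
    unfolding f_def by (rule adj) (use that in \<open>simp add: cartesian_product_def path_graph_def\<close>)
  have up: "l1_dist (f i j) (f i (Suc j)) = 1" if "i < s" "Suc j < r" for i j
    unfolding f_def by (rule adj) (use that in \<open>simp add: cartesian_product_def path_graph_def\<close>)
  have "verts C = iso_verts h ` verts ?H" using Ch by simp
  also have "\<dots> = (\<lambda>(i, j). f i j) ` ({..<s} \<times> {..<r})" unfolding vH by (auto simp: f_def)
  finally have "verts C = (\<lambda>(i, j). f i j) ` ({..<s} \<times> {..<r})" .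
  moreover obtain l m b n where
    "(\<lambda>(i, j). f i j) ` ({..<s} \<times> {..<r}) = {l..l + int m - 1} \<times> {b..b + int n - 1}"
    "m = s \<and> n = r \<or> m = r \<and> n = s"
    by (rule grid_embedding_image_rectangle[where f = f, OF s r]) (rule inj right up that; assumption)+
  ultimately show thesis using that by metis
qed

section \<open>From a dominating set to an octagon tiling\<close>

theorem theorem3:
  fixes s r t :: nat
  assumes "3 \<le> s" and "s \<le> r" and "1 \<le> t"
  shows "\<not> (\<exists>S. PDDS_of (with_proj Lambda2) t (with_proj (path_graph s \<box> path_graph r)) S)"
proof
  assume "\<exists>S. PDDS_of (with_proj Lambda2) t (with_proj (path_graph s \<box> path_graph r)) S"
  then obtain S where S: "PDDS_of (with_proj Lambda2) t (with_proj (path_graph s \<box> path_graph r)) S" ..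
  let ?K = "graph_components (with_proj Lambda2 \<restriction> S)"
  \<comment> \<open>Existence here will give the covering by octagons, uniqueness their
    disjointness.\<close>
  have unique: "\<exists>!C. C \<in> ?K \<and> (\<exists>q\<in>verts C. l1_dist p q \<le> int t)" for p
    using S unfolding PDDS_of_def PDDS_def set_graph_dist_Lambda2_le_iff
    by (simp del: split_paired_All)
  have rect: "\<exists>l r b u. verts C = {l..r} \<times> {b..u} \<and> l + 2 \<le> r \<and> b + 2 \<le> u" if C: "C \<in> ?K" for C
  proof -
    have iso: "digraph_iso C (with_proj (path_graph s \<box> path_graph r))"
      using S C unfolding PDDS_of_def by blast
    have "2 \<le> s" "2 \<le> r" using assms by auto
    then obtain l m b n where
      "verts C = {l..l + int m - 1} \<times> {b..b + int n - 1}" "m = s \<and> n = r \<or> m = r \<and> n = s"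
      by (rule grid_component_rectangle[OF C iso])
    \<comment> \<open>The end coordinates of a side with \<open>k\<close> vertices differ by
      \<open>k - 1\<close>, and both sides have at least three vertices.\<close>
    moreover from this(2) have "l + 2 \<le> l + int m - 1" "b + 2 \<le> b + int n - 1"
      using assms by auto
    ultimately show ?thesis by blast
  qed
  define F where "F = {(l, r, b, u). l + 2 \<le> r \<and> b + 2 \<le> u \<and> (\<exists>C\<in>?K. verts C = {l..r} \<times> {b..u})}"
  have near: "p \<in> octagon (int t) l r b u \<longleftrightarrow> (\<exists>q\<in>{l..r} \<times> {b..u}. l1_dist p q \<le> int t)"
    if "l + 2 \<le> r" "b + 2 \<le> u" for p l r b u
    using that by (cases p) (force simp: octagon_iff_near_rectangle l1_dist_def)
  show False
  proof (rule no_octagon_tiling[of "int t" F])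
    show "1 \<le> int t" using assms by simp
    show "l + 2 \<le> r \<and> b + 2 \<le> u" if "(l, r, b, u) \<in> F" for l r b u
      using that by (simp add: F_def)
    show "\<exists>l r b u. (l, r, b, u) \<in> F \<and> p \<in> octagon (int t) l r b u" for p
    proof -
      obtain C where C: "C \<in> ?K" "\<exists>q\<in>verts C. l1_dist p q \<le> int t" using unique by blast
      then obtain l r b u where R: "verts C = {l..r} \<times> {b..u}" "l + 2 \<le> r" "b + 2 \<le> u"
        using rect by meson
      then have "(l, r, b, u) \<in> F" using C(1) by (auto simp: F_def)
      moreover have "p \<in> octagon (int t) l r b u" using near R C(2) by simp
      ultimately show ?thesis by blast
    qed
    fix p l r b u l' r' b' u'
    assume F: "(l, r, b, u) \<in> F" "(l', r', b', u') \<in> F"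
      and p: "p \<in> octagon (int t) l r b u" "p \<in> octagon (int t) l' r' b' u'"
    from F obtain C C' where C: "C \<in> ?K" "verts C = {l..r} \<times> {b..u}" "l + 2 \<le> r" "b + 2 \<le> u"
      and C': "C' \<in> ?K" "verts C' = {l'..r'} \<times> {b'..u'}" "l' + 2 \<le> r'" "b' + 2 \<le> u'"
      by (auto simp: F_def)
    have "C = C'" using unique[of p] C C' p near by metis
    then have "{l..r} \<times> {b..u} = {l'..r'} \<times> {b'..u'}" using C(2) C'(2) by simp
    \<comment> \<open>The intervals are nonempty, so their product determines all four
      bounds.\<close>
    then show "(l, r, b, u) = (l', r', b', u')" using C(3,4) C'(3,4)
      by (auto simp: times_eq_iff Icc_eq_Icc)
  qed
qed

end
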